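(* Let $(k(n))_{n\ge 1}$ be a sequence of positive integers with $k(n)\to+\infty$, and let $X=\{\{X_{k,n},\ 1\le k\le k(n)\},\ n\ge 1\}$ be an array of random variables defined on the same probability space $(\Omega,\mathcal{A},\mathbb{P})$ such that, for each $n\ge 1$, the variables $X_{1,n},\dots,X_{k(n),n}$ are independent. Suppose that, with $q_{k,n}=1-p_{k,n}$: (GP1) for all $n\ge 1$ and all $1\le k\le k(n)$, $X_{k,n}\sim\mathcal{B}(p_{k,n})$ (Bernoulli) with $0<p_{k,n}<1$; (GP2) $\sup_{1\le k\le k(n)} p_{k,n}(1-p_{k,n})\to 0$ as $n\to+\infty$; (GP3) for some $\lambda\in\,]0,+\infty[$, both $\sum_{1\le k\le k(n)} p_{k,n}(1-p_{k,n})\to\lambda$ and $\sum_{1\le k\le k(n)} p_{k,n}\to\lambda$ as $n\to+\infty$; (GP4) for every $0<\varepsilon<1$, setting for $n\ge 1$ and $1\le k\le k(n)$ $$B(\varepsilon,k,n)=\sum_{j=0}^{1} 1_{\left(|j-p_{k,n}-1|\ge\varepsilon\right)}\,(j-p_{k,n})^2\,p_{k,n}^{j}\,q_{k,n}^{1-j},$$ one has $B(\varepsilon,n)=\sum_{k=1}^{k(n)}B(\varepsilon,k,n)\to 0$ as $n\to+\infty$. Then $S_n[X]=\sum_{k=1}^{k(n)}X_{k,n}$ converges in distribution, as $n\to+\infty$, to the Poisson law $\mathcal{P}(\lambda)$.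
   Context: $\mathcal{B}(p)$ denotes the Bernoulli law with $\mathbb{P}(X=1)=p=1-\mathbb{P}(X=0)$. $\mathcal{P}(\lambda)$ denotes the Poisson law with parameter $\lambda$. $1_{(A)}$ equals $1$ if condition $A$ holds and $0$ otherwise. Within a row the variables need not be identically distributed, and nothing is assumed about dependence between different rows. *)

theory Defs
  imports "HOL-Probability.Probability"
begin

definition bernoulli_law :: "real \<Rightarrow> real measure" where
  "bernoulli_law p = distr (measure_pmf (bernoulli_pmf p)) borel of_bool"

definition poisson_law :: "real \<Rightarrow> real measure" where
  "poisson_law l = distr (measure_pmf (poisson_pmf l)) borel real"

definition has_law :: "'a measure \<Rightarrow> ('a \<Rightarrow> real) \<Rightarrow> real measure \<Rightarrow> bool" where
  "has_law M Y L \<longleftrightarrow> Y \<in> borel_measurable M \<and> distr M borel Y = L"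

(* Arrays are written with the row index n last, as in X_{k,n}. *)

definition B_term :: "(nat \<Rightarrow> nat \<Rightarrow> real) \<Rightarrow> real \<Rightarrow> nat \<Rightarrow> nat \<Rightarrow> real" where
  "B_term p \<epsilon> k n =
     (let q = 1 - p k n in
      \<Sum>j=0..1::nat. of_bool (\<bar>real j - p k n - 1\<bar> \<ge> \<epsilon>) * (real j - p k n)\<^sup>2 * p k n ^ j * q ^ (1 - j))"

definition B_row :: "(nat \<Rightarrow> nat) \<Rightarrow> (nat \<Rightarrow> nat \<Rightarrow> real) \<Rightarrow> real \<Rightarrow> nat \<Rightarrow> real" where
  "B_row K p \<epsilon> n = (\<Sum>k=1..K n. B_term p \<epsilon> k n)"

end

theory Submission
  imports Defs
begin

text \<open>
  By independence the characteristic function of the row sum is the product of the factors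
  \<open>1 + p z\<close> with \<open>z = iexp t - 1\<close>. Since \<open>p\<^sup>2 = p - p (1 - p)\<close>, the two limits in (GP3) together
  say that the row sums of squares tend to 0; hence the product may be replaced by
  \<open>exp (z \<Sum> p)\<close>, which tends to the characteristic function \<open>exp (l z)\<close> of the Poisson law,
  and Levy's continuity theorem applies.
\<close>

lemma char_bernoulli_law:
  assumes "0 \<le> p" "p \<le> 1"
  shows "char (bernoulli_law p) t = 1 + of_real p * (iexp t - 1)"
proof -
  have "char (bernoulli_law p) t = (\<integral>x. iexp (t * of_bool x) \<partial>bernoulli_pmf p)"
    unfolding char_def bernoulli_law_def by (subst integral_distr) simp_all
  also have "\<dots> = 1 + of_real p * (iexp t - 1)"
    using assms
    by (subst integral_measure_pmf [of UNIV])
      (auto simp: UNIV_bool scaleR_conv_of_real algebra_simps)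
  finally show ?thesis .
qed

text \<open>Since \<open>iexp (t * real k)\<close> is a k-th power, the Poisson weights turn the
  expectation into the exponential series at \<open>z = of_real l * iexp t\<close>, scaled by
  \<open>exp (- of_real l)\<close>.\<close>

lemma char_poisson_law:
  assumes "0 < l"
  shows "char (poisson_law l) t = exp (of_real l * (iexp t - 1))"
proof -
  define z where "z = of_real l * iexp t"
  define f :: "nat \<Rightarrow> complex" where "f k = pmf (poisson_pmf l) k *\<^sub>R iexp (t * real k)" for k
  have f_eq: "f k = exp (- of_real l) * (z ^ k /\<^sub>R fact k)" for k
  proof -
    have "iexp (t * real k) = iexp t ^ k"
      by (simp add: exp_of_nat_mult [symmetric] mult_ac)
    then show ?thesis
      using assms
      by (simp add: f_def z_def scaleR_conv_of_real exp_of_real [symmetric] exp_minus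
          power_mult_distrib field_simps)
  qed
  have "f sums (exp (- of_real l) * exp z)"
    unfolding f_eq by (intro sums_mult exp_converges)
  moreover have "integrable (count_space UNIV) f"
    unfolding integrable_count_space_nat_iff f_eq norm_mult
    by (intro summable_mult summable_norm_exp)
  ultimately have "integral\<^sup>L (count_space UNIV) f = exp (- of_real l) * exp z"
    by (simp add: integral_count_space_nat sums_iff)
  \<comment> \<open>The law has density \<open>pmf (poisson_pmf l)\<close> with respect to counting
    measure, so the expectation is the sum of the series \<open>f\<close>.\<close>
  moreover have "char (poisson_law l) t = integral\<^sup>L (count_space UNIV) f"
    unfolding char_def poisson_law_def f_def
    by (subst integral_distr) (simp_all add: measure_pmf_eq_density integral_density)
  ultimately show ?thesis
    by (simp add: z_def exp_add [symmetric] algebra_simps)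
qed

lemma real_distribution_poisson_law: "real_distribution (poisson_law l)"
  unfolding poisson_law_def
  by (rule prob_space.real_distribution_distr [OF measure_pmf.prob_space_axioms]) simp

text \<open>This is the first-order Taylor remainder of \<open>exp\<close> at \<open>?w\<close>. As
  the norm of \<open>?w\<close> is at most \<open>2 * p\<close>, squaring gives the factor 4, and
  \<open>p \<le> 1\<close> bounds the exponential factor by \<open>exp 2\<close>.\<close>

lemma norm_one_plus_minus_exp_le:
  fixes z :: complex and p :: real
  assumes "0 \<le> p" "p \<le> 1" "norm z \<le> 2"
  shows "norm ((1 + of_real p * z) - exp (of_real p * z)) \<le> 4 * exp 2 * p\<^sup>2"
proof -
  let ?w = "of_real p * z"
  have w: "norm ?w \<le> 2 * p"
    using assms by (simp add: norm_mult mult.commute [of 2] mult_left_mono)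
  have "norm ((1 + ?w) - exp ?w) = norm (exp ?w - (\<Sum>k\<le>1. ?w ^ k / fact k))"
    by (simp add: norm_minus_commute)
  also have "\<dots> \<le> exp \<bar>Re ?w\<bar> * norm ?w ^ Suc 1 / fact 1"
    by (rule Taylor_exp)
  also have "\<dots> = exp \<bar>Re ?w\<bar> * norm ?w ^ 2"
    by (simp add: numeral_2_eq_2)
  also have "\<dots> \<le> exp 2 * (2 * p) ^ 2"
    using w abs_Re_le_cmod [of ?w] assms(2)
    by (intro mult_mono power_mono) auto
  finally show ?thesis
    by (simp add: power2_eq_square mult_ac)
qed

text \<open>Factors in the closed unit disc let the difference of two products be bounded by the sum
  of the differences of the factors, each of which is quadratic in \<open>p k\<close>.\<close>

lemma norm_prod_one_plus_minus_exp_sum_le: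
  fixes p :: "nat \<Rightarrow> real" and t :: real
  defines "z \<equiv> iexp t - 1"
  assumes "finite A" and p: "\<And>k. k \<in> A \<Longrightarrow> 0 \<le> p k \<and> p k \<le> 1"
  shows "norm ((\<Prod>k\<in>A. 1 + of_real (p k) * z) - exp (z * of_real (\<Sum>k\<in>A. p k)))
           \<le> 4 * exp 2 * (\<Sum>k\<in>A. (p k)\<^sup>2)"
proof -
  have z2: "norm z \<le> 2"
    using norm_triangle_ineq4 [of "iexp t" 1] by (simp add: z_def)
  \<comment> \<open>The real part is \<open>cos t - 1\<close>; its sign keeps the exponential
    factors in the unit disc.\<close>
  have Re_z: "Re z \<le> 0"
    by (simp add: z_def Re_exp)
  have 1: "norm (1 + of_real (p k) * z) \<le> 1" if "k \<in> A" for k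
  proof -
    \<comment> \<open>A convex combination of two points of the unit circle, 1 and
      \<open>iexp t\<close>.\<close>
    have "1 + of_real (p k) * z = of_real (1 - p k) + of_real (p k) * iexp t"
      by (simp add: z_def algebra_simps)
    also have "norm \<dots> \<le> norm (of_real (1 - p k) :: complex) + norm (of_real (p k) * iexp t)"
      by (rule norm_triangle_ineq)
    also have "\<dots> = 1"
      using p [OF that] by (simp add: norm_mult del: of_real_diff)
    finally show ?thesis .
  qed
  have 2: "norm (exp (of_real (p k) * z)) \<le> 1" if "k \<in> A" for k
    using p [OF that] Re_z by (simp add: mult_nonneg_nonpos)
  have "exp (z * of_real (\<Sum>k\<in>A. p k)) = (\<Prod>k\<in>A. exp (of_real (p k) * z))"
    using \<open>finite A\<close> by (simp add: exp_sum sum_distrib_left mult.commute)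
  then have "norm ((\<Prod>k\<in>A. 1 + of_real (p k) * z) - exp (z * of_real (\<Sum>k\<in>A. p k)))
      \<le> (\<Sum>k\<in>A. norm ((1 + of_real (p k) * z) - exp (of_real (p k) * z)))"
    using 1 2 by (simp only:) (rule norm_prod_diff)
  also have "\<dots> \<le> (\<Sum>k\<in>A. 4 * exp 2 * (p k)\<^sup>2)"
    using p z2 by (intro sum_mono norm_one_plus_minus_exp_le) auto
  finally show ?thesis
    by (simp add: sum_distrib_left)
qed

theorem theorem3:
  fixes M :: "'a measure"
    and K :: "nat \<Rightarrow> nat"
    and X :: "nat \<Rightarrow> nat \<Rightarrow> 'a \<Rightarrow> real"
    and p :: "nat \<Rightarrow> nat \<Rightarrow> real"
    and l :: real
  assumes prob: "prob_space M"
    and K_pos: "\<And>n. n \<ge> 1 \<Longrightarrow> K n > 0"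
    and K_lim: "filterlim K at_top sequentially"
    and indep: "\<And>n. n \<ge> 1 \<Longrightarrow> prob_space.indep_vars M (\<lambda>_. borel) (\<lambda>k. X k n) {1..K n}"
    and GP1: "\<And>n k. n \<ge> 1 \<Longrightarrow> k \<in> {1..K n} \<Longrightarrow>
               0 < p k n \<and> p k n < 1 \<and> has_law M (X k n) (bernoulli_law (p k n))"
    and GP2: "(\<lambda>n. SUP k\<in>{1..K n}. p k n * (1 - p k n)) \<longlonglongrightarrow> 0"
    and l_pos: "0 < l"
    and GP3a: "(\<lambda>n. \<Sum>k=1..K n. p k n * (1 - p k n)) \<longlonglongrightarrow> l"
    and GP3b: "(\<lambda>n. \<Sum>k=1..K n. p k n) \<longlonglongrightarrow> l"
    and GP4: "\<And>\<epsilon>. 0 < \<epsilon> \<Longrightarrow> \<epsilon> < 1 \<Longrightarrow> (\<lambda>n. B_row K p \<epsilon> n) \<longlonglongrightarrow> 0"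
  shows "weak_conv_m (\<lambda>n. distr M borel (\<lambda>\<omega>. \<Sum>k=1..K n. X k n \<omega>)) (poisson_law l)"
proof -
  interpret prob_space M by (rule prob)
  define S where "S n = distr M borel (\<lambda>\<omega>. \<Sum>k=1..K n. X k n \<omega>)" for n
  have X_meas [measurable]: "X k n \<in> borel_measurable M" if "n \<ge> 1" "k \<in> {1..K n}" for k n
    using GP1 [OF that] by (simp add: has_law_def)
  have S_dist: "real_distribution (S (Suc n))" for n
    unfolding S_def using X_meas by (intro real_distribution_distr borel_measurable_sum) auto
  have char_S: "char (S n) t = (\<Prod>k=1..K n. 1 + of_real (p k n) * (iexp t - 1))" if "n \<ge> 1" for n t
  proof -
    have "char (distr M borel (X k n)) t = 1 + of_real (p k n) * (iexp t - 1)" if "k \<in> {1..K n}" for k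
      using GP1 [OF \<open>n \<ge> 1\<close> that] by (simp add: has_law_def char_bernoulli_law del: of_real_mult)
    then show ?thesis
      unfolding S_def char_distr_sum [OF indep [OF that]] by (intro prod.cong) auto
  qed
  have sum_sq: "(\<lambda>n. \<Sum>k=1..K n. (p k n)\<^sup>2) \<longlonglongrightarrow> 0"
    using tendsto_diff [OF GP3b GP3a]
    by (simp add: sum_subtractf [symmetric] power2_eq_square algebra_simps)
  have char_lim: "(\<lambda>n. char (S n) t) \<longlonglongrightarrow> char (poisson_law l) t" for t
  proof -
    define z where "z = iexp t - 1"
    \<comment> \<open>For \<open>n \<ge> 1\<close>, \<open>E n\<close> is the characteristic
      function at \<open>t\<close> of the Poisson law with the same mean as the row sum.\<close>
    define E where "E n = exp (z * of_real (\<Sum>k=1..K n. p k n))" for n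
    have "eventually (\<lambda>n. norm (char (S n) t - E n) \<le> 4 * exp 2 * (\<Sum>k=1..K n. (p k n)\<^sup>2)) sequentially"
      using eventually_ge_at_top [of 1]
    proof eventually_elim
      case (elim n)
      show ?case
        unfolding char_S [OF elim] E_def z_def
        using GP1 [OF elim] by (intro norm_prod_one_plus_minus_exp_sum_le) (auto intro: less_imp_le)
    qed
    then have "(\<lambda>n. char (S n) t - E n) \<longlonglongrightarrow> 0"
      by (rule Lim_null_comparison) (use tendsto_mult_right_zero [OF sum_sq] in simp)
    moreover have "E \<longlonglongrightarrow> exp (z * of_real l)"
      unfolding E_def by (intro tendsto_intros GP3b)
    ultimately have "(\<lambda>n. (char (S n) t - E n) + E n) \<longlonglongrightarrow> 0 + exp (z * of_real l)"
      by (rule tendsto_add)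
    then show ?thesis
      by (simp add: char_poisson_law [OF l_pos] z_def mult.commute)
  qed
  \<comment> \<open>Row 0 is unconstrained and may fail to be measurable, so Levy's theorem is applied from row 1 on.\<close>
  have "weak_conv_m (\<lambda>n. S (Suc n)) (poisson_law l)"
    by (intro levy_continuity S_dist real_distribution_poisson_law LIMSEQ_Suc char_lim)
  \<comment> \<open>Weak convergence unfolds to limits of distribution functions at continuity
    points; each is a limit of a real sequence, so the index shift can be undone pointwise.\<close>
  then have "weak_conv_m S (poisson_law l)"
    unfolding weak_conv_m_def weak_conv_def by (blast intro: LIMSEQ_imp_Suc)
  then show ?thesis
    unfolding S_def .
qed

end
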